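(* For every $s>0$, $(\mathit{Conf},d_H)$ is a compact metric space, and thus a Baire space.
   Context: Let $d$ be the $L^1$ distance on $\mathbb R^2$ and fix $s>0$. A configuration is an at most countable (possibly finite or empty) subset $g\subset\mathbb R^2$ such that $d(z_1,z_2)\ge s$ for all distinct $z_1,z_2\in g$. $\mathit{Conf}$ is the set of all configurations. Identify $\mathbb R^2$ with the unit sphere minus the north pole $\infty$ by inverse stereographic projection: the point with polar coordinates $(r,\theta)$ corresponds to the point of the sphere with spherical coordinates $(2\arctan(1/r),\theta)$ (the first coordinate being the angle from the north pole). For $g\in\mathit{Conf}$ let $\hat g$ be the image of $g$ on the sphere together with the point $\infty$; it is a closed subset of the sphere. With $\rho$ the geodesic distance on the sphere, $$d_H(g_1,g_2)=\max\Big(\sup_{z_1\in\hat g_1}\inf_{z_2\in\hat g_2}\rho(z_1,z_2),\ \sup_{z_2\in\hat g_2}\inf_{z_1\in\hat g_1}\rho(z_1,z_2)\Big).$$ *)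

theory Defs
  imports "HOL-Analysis.Analysis"
begin

definition l1_dist :: "real \<times> real \<Rightarrow> real \<times> real \<Rightarrow> real" where
  "l1_dist z w = \<bar>fst z - fst w\<bar> + \<bar>snd z - snd w\<bar>"

definition Conf :: "real \<Rightarrow> (real \<times> real) set set" where
  "Conf s = {g. countable g \<and> pairwise (\<lambda>z w. l1_dist z w \<ge> s) g}"

text \<open>The point of the unit sphere at angle \<open>\<phi>\<close> from the north pole and azimuth \<open>\<theta>\<close>.\<close>

definition sphere_point :: "real \<Rightarrow> real \<Rightarrow> real \<times> real \<times> real" where
  "sphere_point \<phi> \<theta> = (sin \<phi> * cos \<theta>, sin \<phi> * sin \<theta>, cos \<phi>)"

definition north_pole :: "real \<times> real \<times> real" where
  "north_pole = (0, 0, 1)"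

text \<open>For \<open>r = 0\<close> the angle \<open>2 arctan (1/r)\<close> is read as its limit \<open>\<pi>\<close>, the south pole; in HOL
  \<open>1 / 0 = 0\<close> would give the north pole instead.\<close>

definition inv_stereo :: "real \<times> real \<Rightarrow> real \<times> real \<times> real" where
  "inv_stereo z =
     (let r = norm z; \<theta> = Arg (Complex (fst z) (snd z))
      in sphere_point (if r = 0 then pi else 2 * arctan (1 / r)) \<theta>)"

lemma inv_stereo_polar:
  assumes "r > 0"
  shows "inv_stereo (r * cos \<theta>, r * sin \<theta>) = sphere_point (2 * arctan (1 / r)) \<theta>"
proof -
  let ?c = "Complex (r * cos \<theta>) (r * sin \<theta>)"
  have n: "norm (r * cos \<theta>, r * sin \<theta>) = r"
  proof -
    have "(r * cos \<theta>)\<^sup>2 + (r * sin \<theta>)\<^sup>2 = r\<^sup>2 * ((cos \<theta>)\<^sup>2 + (sin \<theta>)\<^sup>2)"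
      by (simp only: power_mult_distrib distrib_left)
    then show ?thesis using assms by (simp add: norm_Pair)
  qed
  then have "cmod ?c = r" by (simp add: norm_Pair cmod_def)
  then have "?c = of_real r * cis (Arg ?c)"
    by (metis rcis_cmod_Arg rcis_def)
  then have "r * cos \<theta> = r * cos (Arg ?c)" "r * sin \<theta> = r * sin (Arg ?c)"
    by (simp_all add: complex_eq_iff)
  with assms n show ?thesis
    by (simp add: inv_stereo_def sphere_point_def Let_def)
qed

lemma inv_stereo_origin: "inv_stereo (0, 0) = (0, 0, - 1)"
  by (simp add: inv_stereo_def sphere_point_def Let_def norm_Pair)

definition hat :: "(real \<times> real) set \<Rightarrow> (real \<times> real \<times> real) set" where
  "hat g = insert north_pole (inv_stereo ` g)"

text \<open>On the unit sphere the length of a shortest great-circle arc between \<open>x\<close> and \<open>y\<close> is the angle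
  between them as vectors.\<close>

definition geodesic_dist :: "real \<times> real \<times> real \<Rightarrow> real \<times> real \<times> real \<Rightarrow> real" where
  "geodesic_dist x y = arccos (x \<bullet> y)"

definition d_H :: "(real \<times> real) set \<Rightarrow> (real \<times> real) set \<Rightarrow> real" where
  "d_H g1 g2 = max (SUP z1\<in>hat g1. INF z2\<in>hat g2. geodesic_dist z1 z2)
                   (SUP z2\<in>hat g2. INF z1\<in>hat g1. geodesic_dist z1 z2)"

definition Baire_space :: "'a topology \<Rightarrow> bool" where
  "Baire_space X \<longleftrightarrow>
     (\<forall>\<G>. countable \<G> \<and> (\<forall>U\<in>\<G>. openin X U \<and> X closure_of U = topspace X)
        \<longrightarrow> X closure_of (topspace X \<inter> \<Inter>\<G>) = topspace X)"

end

theory Submission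
  imports Defs "HOL-Complex_Analysis.Great_Picard"
begin

text \<open>
  The distance functions to the sets \<open>hat (g n)\<close> of a sequence of configurations are bounded and
  equicontinuous on the sphere, so by Arzela--Ascoli a subsequence converges uniformly to some
  \<open>f\<close>, which is then the distance function of its zero set \<open>F\<close>. Every point of \<open>F\<close>
  other than the pole is a limit of points of the \<open>g n\<close>, so the separation by \<open>s\<close> passes to the
  limit: \<open>F = hat g\<close> for a configuration \<open>g\<close>, and uniform convergence of the distance functions is
  convergence for \<open>d_H\<close>.
\<close>

section \<open>The angular distance on the unit sphere\<close>

lemma unit_inner_bounds:
  fixes x y :: "'a::real_inner"
  assumes "x \<in> sphere 0 1" "y \<in> sphere 0 1"
  shows "\<bar>x \<bullet> y\<bar> \<le> 1" "-1 \<le> x \<bullet> y" "x \<bullet> y \<le> 1"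
proof -
  show "\<bar>x \<bullet> y\<bar> \<le> 1"
    using Cauchy_Schwarz_ineq2[of x y] assms by simp
  then show "-1 \<le> x \<bullet> y" "x \<bullet> y \<le> 1" by linarith+
qed

lemma unit_inner_eq_1_iff:
  fixes x y :: "'a::real_inner"
  assumes "x \<in> sphere 0 1" "y \<in> sphere 0 1"
  shows "x \<bullet> y = 1 \<longleftrightarrow> x = y"
proof -
  have "(norm (x - y))\<^sup>2 = 2 - 2 * (x \<bullet> y)"
    using assms by (simp add: power2_norm_eq_inner inner_diff inner_commute norm_eq_1)
  then show ?thesis
    by (smt (verit) norm_eq_zero right_minus_eq zero_eq_power2)
qed

lemma geodesic_dist_bounds:
  assumes "x \<in> sphere 0 1" "y \<in> sphere 0 1"
  shows "0 \<le> geodesic_dist x y" "geodesic_dist x y \<le> pi"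
  using unit_inner_bounds[OF assms] by (auto simp: geodesic_dist_def arccos_lbound arccos_ubound)

lemma geodesic_dist_commute: "geodesic_dist x y = geodesic_dist y x"
  by (simp add: geodesic_dist_def inner_commute)

lemma geodesic_dist_eq_0_iff:
  assumes "x \<in> sphere 0 1" "y \<in> sphere 0 1"
  shows "geodesic_dist x y = 0 \<longleftrightarrow> x = y"
  using unit_inner_bounds[OF assms] unit_inner_eq_1_iff[OF assms]
  by (simp add: geodesic_dist_def arccos_eq_0_iff)

text \<open>Removing from \<open>x\<close> and \<open>z\<close> their components along
  \<open>y\<close> leaves tangent vectors at \<open>y\<close> of lengths \<open>sin a\<close> and
  \<open>sin b\<close>. Cauchy-Schwarz for these, with the addition formula, gives
  \<open>cos (a + b) \<le> x \<bullet> z\<close>, and \<open>arccos\<close> is decreasing.\<close>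

lemma geodesic_dist_triangle:
  assumes x: "x \<in> sphere 0 1" and y: "y \<in> sphere 0 1" and z: "z \<in> sphere 0 1"
  shows "geodesic_dist x z \<le> geodesic_dist x y + geodesic_dist y z"
proof -
  define a where "a = geodesic_dist x y"
  define b where "b = geodesic_dist y z"
  have ab: "0 \<le> a" "a \<le> pi" "0 \<le> b" "b \<le> pi"
    using geodesic_dist_bounds x y z by (auto simp: a_def b_def)
  have cos: "cos a = x \<bullet> y" "cos b = y \<bullet> z"
    using unit_inner_bounds[OF x y] unit_inner_bounds[OF y z]
    by (simp_all add: a_def b_def geodesic_dist_def cos_arccos)
  have unit: "x \<bullet> x = 1" "y \<bullet> y = 1" "z \<bullet> z = 1"
    using x y z by (simp_all add: norm_eq_1)
  define u where "u = x - cos a *\<^sub>R y"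
  define v where "v = z - cos b *\<^sub>R y"
  have "(norm u)\<^sup>2 = 1 - (cos a)\<^sup>2"
    unfolding u_def power2_norm_eq_inner by (simp add: inner_diff inner_commute unit cos power2_eq_square)
  then have nu: "norm u = sin a"
    using ab sin_ge_zero[of a]
    by (metis add_diff_cancel_right' norm_ge_zero power2_eq_imp_eq sin_cos_squared_add)
  have "(norm v)\<^sup>2 = 1 - (cos b)\<^sup>2"
    unfolding v_def power2_norm_eq_inner by (simp add: inner_diff inner_commute unit cos power2_eq_square)
  then have nv: "norm v = sin b"
    using ab sin_ge_zero[of b]
    by (metis add_diff_cancel_right' norm_ge_zero power2_eq_imp_eq sin_cos_squared_add)
  have "u \<bullet> v = x \<bullet> z - cos a * cos b"
    by (simp add: u_def v_def inner_diff inner_commute unit cos)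
  moreover have "\<bar>u \<bullet> v\<bar> \<le> sin a * sin b"
    using Cauchy_Schwarz_ineq2[of u v] nu nv by simp
  ultimately have le: "cos (a + b) \<le> x \<bullet> z"
    by (simp add: cos_add abs_le_iff)
  show ?thesis
  \<comment> \<open>\<open>arccos\<close> inverts \<open>cos\<close> only on \<open>[0, pi]\<close>;
    beyond \<open>pi\<close> the claim follows from the bound \<open>pi\<close> on every
    distance.\<close>
  proof (cases "a + b \<le> pi")
    case True
    have "arccos (x \<bullet> z) \<le> arccos (cos (a + b))"
      using le unit_inner_bounds[OF x z] by (simp add: arccos_le_mono)
    also have "\<dots> = a + b"
      using True ab by (simp add: arccos_cos)
    finally show ?thesis by (simp add: a_def b_def geodesic_dist_def)
  next
    case False
    then show ?thesis
      using geodesic_dist_bounds[OF x z] by (simp add: a_def b_def)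
  qed
qed

lemma continuous_on_geodesic_dist:
  assumes "x \<in> sphere 0 1"
  shows "continuous_on (sphere 0 1) (geodesic_dist x)"
  unfolding geodesic_dist_def
  by (intro continuous_intros) (use unit_inner_bounds assms in auto)

section \<open>Angular distance to a set\<close>

text \<open>The counterpart of \<open>infdist\<close> for the angular distance;
  \<open>infdist\<close> itself measures by the Euclidean, that is chordal, distance.\<close>

definition geodesic_infdist :: "real \<times> real \<times> real \<Rightarrow> (real \<times> real \<times> real) set \<Rightarrow> real" where
  "geodesic_infdist x A = (INF a\<in>A. geodesic_dist x a)"

lemma geodesic_infdist_le:
  assumes "x \<in> sphere 0 1" "A \<subseteq> sphere 0 1" "a \<in> A"
  shows "geodesic_infdist x A \<le> geodesic_dist x a"
  unfolding geodesic_infdist_def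
  by (rule cINF_lower[OF bdd_belowI2[where m = 0]]) (use assms geodesic_dist_bounds(1) in blast)+

lemma geodesic_infdist_greatest:
  assumes "A \<noteq> {}" "\<And>a. a \<in> A \<Longrightarrow> c \<le> geodesic_dist x a"
  shows "c \<le> geodesic_infdist x A"
  unfolding geodesic_infdist_def using assms by (rule cINF_greatest)

lemma geodesic_infdist_bounds:
  assumes "x \<in> sphere 0 1" "A \<subseteq> sphere 0 1" "A \<noteq> {}"
  shows "0 \<le> geodesic_infdist x A" "geodesic_infdist x A \<le> pi"
proof -
  show "0 \<le> geodesic_infdist x A"
    using assms geodesic_dist_bounds(1) by (intro geodesic_infdist_greatest) blast+
  obtain a where "a \<in> A" using assms by auto
  then have "geodesic_infdist x A \<le> geodesic_dist x a"
    using assms geodesic_infdist_le by blast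
  also have "\<dots> \<le> pi"
    using \<open>a \<in> A\<close> assms geodesic_dist_bounds by blast
  finally show "geodesic_infdist x A \<le> pi" .
qed

lemma geodesic_infdist_triangle:
  assumes "x \<in> sphere 0 1" "y \<in> sphere 0 1" "A \<subseteq> sphere 0 1" "A \<noteq> {}"
  shows "geodesic_infdist x A \<le> geodesic_dist x y + geodesic_infdist y A"
proof -
  have "geodesic_infdist x A - geodesic_dist x y \<le> geodesic_infdist y A"
  proof (rule geodesic_infdist_greatest)
    fix a assume "a \<in> A"
    then show "geodesic_infdist x A - geodesic_dist x y \<le> geodesic_dist y a"
      using geodesic_infdist_le[of x A a] geodesic_dist_triangle[of x y a] assms by auto
  qed fact
  then show ?thesis by simp
qed

text \<open>The constant 1 does not depend on \<open>A\<close>: this is the source of equicontinuity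
  for a sequence of sets.\<close>

lemma geodesic_infdist_Lipschitz:
  assumes "x \<in> sphere 0 1" "y \<in> sphere 0 1" "A \<subseteq> sphere 0 1" "A \<noteq> {}"
  shows "\<bar>geodesic_infdist x A - geodesic_infdist y A\<bar> \<le> geodesic_dist x y"
  using geodesic_infdist_triangle[of x y A] geodesic_infdist_triangle[of y x A] assms
  by (simp add: geodesic_dist_commute[of y x])

lemma geodesic_infdist_attained:
  assumes "x \<in> sphere 0 1" "A \<subseteq> sphere 0 1" "A \<noteq> {}" "closed A"
  obtains a where "a \<in> A" "geodesic_dist x a = geodesic_infdist x A"
proof -
  have "compact A"
    using assms compact_Int_closed[OF compact_sphere[of 0 1] \<open>closed A\<close>]
    by (simp add: inf_absorb2)
  then obtain a where a: "a \<in> A" "\<And>b. b \<in> A \<Longrightarrow> geodesic_dist x a \<le> geodesic_dist x b"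
    using continuous_attains_inf[of A "geodesic_dist x"] assms
      continuous_on_subset[OF continuous_on_geodesic_dist] by metis
  then show ?thesis
    using that[of a] geodesic_infdist_le[of x A a] geodesic_infdist_greatest[of A _ x] assms
    by (metis antisym)
qed

lemma geodesic_infdist_self:
  assumes "A \<subseteq> sphere 0 1" "a \<in> A"
  shows "geodesic_infdist a A = 0"
proof -
  have a: "a \<in> sphere 0 1" using assms by blast
  have "geodesic_infdist a A \<le> 0"
    using geodesic_infdist_le[OF a assms] geodesic_dist_eq_0_iff[OF a a] by simp
  moreover have "0 \<le> geodesic_infdist a A"
    using assms by (intro geodesic_infdist_bounds(1)[OF a]) auto
  ultimately show ?thesis by simp
qed

lemma geodesic_infdist_eq_0_iff:
  assumes "x \<in> sphere 0 1" "A \<subseteq> sphere 0 1" "A \<noteq> {}" "closed A"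
  shows "geodesic_infdist x A = 0 \<longleftrightarrow> x \<in> A"
proof
  assume "geodesic_infdist x A = 0"
  moreover obtain a where a: "a \<in> A" "geodesic_dist x a = geodesic_infdist x A"
    using geodesic_infdist_attained[OF assms] .
  moreover have "a \<in> sphere 0 1" using a(1) assms(2) by blast
  ultimately have "x = a"
    using geodesic_dist_eq_0_iff[OF assms(1)] by simp
  then show "x \<in> A" using a(1) by simp
qed (rule geodesic_infdist_self[OF assms(2)])

section \<open>Hausdorff distance\<close>

text \<open>The one-sided Hausdorff distance; \<open>d_H\<close> is the maximum of its two
  directions.\<close>

definition geodesic_excess ::
    "(real \<times> real \<times> real) set \<Rightarrow> (real \<times> real \<times> real) set \<Rightarrow> real" where
  "geodesic_excess A B = (SUP a\<in>A. geodesic_infdist a B)"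

lemma geodesic_infdist_le_excess:
  assumes "A \<subseteq> sphere 0 1" "B \<subseteq> sphere 0 1" "B \<noteq> {}" "a \<in> A"
  shows "geodesic_infdist a B \<le> geodesic_excess A B"
  unfolding geodesic_excess_def
  \<comment> \<open>\<open>pi\<close> bounds all distances on the sphere; a real supremum is an
    upper bound only for a family bounded above.\<close>
  by (rule cSUP_upper[OF _ bdd_aboveI2[where M = pi]])
     (use assms geodesic_infdist_bounds(2) in blast)+

lemma geodesic_excess_least:
  assumes "A \<noteq> {}" "\<And>a. a \<in> A \<Longrightarrow> geodesic_infdist a B \<le> c"
  shows "geodesic_excess A B \<le> c"
  unfolding geodesic_excess_def using assms by (rule cSUP_least)

lemma geodesic_excess_nonneg:
  assumes "A \<subseteq> sphere 0 1" "A \<noteq> {}" "B \<subseteq> sphere 0 1" "B \<noteq> {}"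
  shows "0 \<le> geodesic_excess A B"
proof -
  obtain a where a: "a \<in> A" using assms(2) by blast
  then have "0 \<le> geodesic_infdist a B"
    using assms by (intro geodesic_infdist_bounds(1)) blast+
  also have "\<dots> \<le> geodesic_excess A B"
    using assms a by (intro geodesic_infdist_le_excess)
  finally show ?thesis .
qed

text \<open>From \<open>a\<close>, go to an arbitrary \<open>b\<close> in \<open>B\<close> and on to
  \<open>C\<close>; the second leg costs at most the excess of \<open>B\<close> over
  \<open>C\<close>, whatever \<open>b\<close> is, so the infimum over \<open>b\<close> can be
  taken.\<close>

lemma geodesic_excess_triangle:
  assumes "A \<subseteq> sphere 0 1" "A \<noteq> {}" "B \<subseteq> sphere 0 1" "B \<noteq> {}" "C \<subseteq> sphere 0 1" "C \<noteq> {}"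
  shows "geodesic_excess A C \<le> geodesic_excess A B + geodesic_excess B C"
proof (rule geodesic_excess_least)
  fix a assume a: "a \<in> A"
  have "geodesic_infdist a C - geodesic_excess B C \<le> geodesic_infdist a B"
  proof (rule geodesic_infdist_greatest)
    fix b assume b: "b \<in> B"
    have "geodesic_infdist a C \<le> geodesic_dist a b + geodesic_infdist b C"
      using assms a b by (intro geodesic_infdist_triangle) blast+
    moreover have "geodesic_infdist b C \<le> geodesic_excess B C"
      using assms b by (intro geodesic_infdist_le_excess)
    ultimately show "geodesic_infdist a C - geodesic_excess B C \<le> geodesic_dist a b"
      by linarith
  qed fact
  then show "geodesic_infdist a C \<le> geodesic_excess A B + geodesic_excess B C"
    using geodesic_infdist_le_excess[of A B a] assms a by linarith
qed fact

lemma geodesic_excess_eq_0_imp_subset: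
  assumes "A \<subseteq> sphere 0 1" "B \<subseteq> sphere 0 1" "B \<noteq> {}" "closed B" "geodesic_excess A B \<le> 0"
  shows "A \<subseteq> B"
proof
  fix a assume "a \<in> A"
  then have "geodesic_infdist a B = 0"
    using geodesic_infdist_le_excess[of A B a] geodesic_infdist_bounds(1)[of a B] assms
    by fastforce
  then show "a \<in> B"
    using geodesic_infdist_eq_0_iff[of a B] assms \<open>a \<in> A\<close> by blast
qed

lemma geodesic_excess_self:
  assumes "A \<subseteq> sphere 0 1" "A \<noteq> {}"
  shows "geodesic_excess A A = 0"
  using assms by (simp add: geodesic_excess_def geodesic_infdist_self)

section \<open>Stereographic projection\<close>

lemma sin_2_arctan: "sin (2 * arctan t) = 2 * t / (1 + t\<^sup>2)"
  by (simp add: sin_double sin_arctan cos_arctan)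

lemma cos_2_arctan: "cos (2 * arctan t) = (1 - t\<^sup>2) / (1 + t\<^sup>2)"
  by (simp add: cos_double sin_arctan cos_arctan power_divide diff_divide_distrib)

text \<open>The tangent half-angle formulas with \<open>t = 1 / r\<close> replace the spherical
  coordinates by rational functions of \<open>z\<close>; the result also covers the origin, so no
  later proof has to split cases there.\<close>

lemma inv_stereo_eq:
  "inv_stereo z = (2 * fst z / ((norm z)\<^sup>2 + 1), 2 * snd z / ((norm z)\<^sup>2 + 1),
     ((norm z)\<^sup>2 - 1) / ((norm z)\<^sup>2 + 1))"
proof (cases "z = 0")
  case True
  then show ?thesis
    using inv_stereo_origin by (simp add: zero_prod_def)
next
  case False
  define r where "r = norm z"
  define \<theta> where "\<theta> = Arg (Complex (fst z) (snd z))"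
  have r: "r > 0" using False by (simp add: r_def)
  have "cmod (Complex (fst z) (snd z)) = r"
    by (simp add: r_def cmod_def norm_prod_def)
  then have "Complex (fst z) (snd z) = of_real r * cis \<theta>"
    unfolding \<theta>_def by (metis rcis_cmod_Arg rcis_def)
  then have z: "fst z = r * cos \<theta>" "snd z = r * sin \<theta>"
    by (simp_all add: complex_eq_iff)
  have "sin (2 * arctan (1 / r)) = 2 * (1 / r) / (1 + (1 / r)\<^sup>2)"
    by (rule sin_2_arctan)
  also have "\<dots> = 2 * r / (r\<^sup>2 + 1)"
    using r by (simp add: field_simps power2_eq_square)
  finally have s: "sin (2 * arctan (1 / r)) = 2 * r / (r\<^sup>2 + 1)" .
  have "cos (2 * arctan (1 / r)) = (1 - (1 / r)\<^sup>2) / (1 + (1 / r)\<^sup>2)"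
    by (rule cos_2_arctan)
  also have "\<dots> = (r\<^sup>2 - 1) / (r\<^sup>2 + 1)"
  proof -
    have "r\<^sup>2 + 1 > 0" by (simp add: add_nonneg_pos)
    moreover have "1 + (1 / r)\<^sup>2 = (r\<^sup>2 + 1) / r\<^sup>2" "1 - (1 / r)\<^sup>2 = (r\<^sup>2 - 1) / r\<^sup>2"
      using r by (simp_all add: field_simps)
    ultimately show ?thesis using r by simp
  qed
  finally have c: "cos (2 * arctan (1 / r)) = (r\<^sup>2 - 1) / (r\<^sup>2 + 1)" .
  have "inv_stereo z = sphere_point (2 * arctan (1 / r)) \<theta>"
    using inv_stereo_polar[OF r, of \<theta>] by (simp flip: z)
  then show ?thesis
    by (simp add: sphere_point_def s c z flip: r_def)
qed

text \<open>Projection from the north pole. At the pole itself division by zero yields the origin, a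
  meaningless value that the lemmas below exclude.\<close>

definition stereo :: "real \<times> real \<times> real \<Rightarrow> real \<times> real" where
  "stereo x = (fst x / (1 - snd (snd x)), fst (snd x) / (1 - snd (snd x)))"

lemma stereo_inv_stereo: "stereo (inv_stereo z) = z"
proof -
  have pos: "(norm z)\<^sup>2 + 1 > 0" by (simp add: add_nonneg_pos)
  then have "1 - ((norm z)\<^sup>2 - 1) / ((norm z)\<^sup>2 + 1) = 2 / ((norm z)\<^sup>2 + 1)"
    by (simp add: field_simps)
  then show ?thesis
    using pos by (simp add: stereo_def inv_stereo_eq)
qed

lemma norm_prod_square: "(norm z)\<^sup>2 = (fst z)\<^sup>2 + (snd z)\<^sup>2" for z :: "real \<times> real"
  by (simp add: norm_prod_def)

lemma mem_unit_sphere_iff: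
  "x \<in> sphere 0 1 \<longleftrightarrow> (fst x)\<^sup>2 + (fst (snd x))\<^sup>2 + (snd (snd x))\<^sup>2 = 1"
  for x :: "real \<times> real \<times> real"
  by (simp add: norm_prod_def add.assoc)

lemma inv_stereo_in_sphere: "inv_stereo z \<in> sphere 0 1"
proof -
  define n where "n = (norm z)\<^sup>2"
  have pos: "n + 1 > 0" by (simp add: n_def add_nonneg_pos)
  have "(2 * fst z)\<^sup>2 + (2 * snd z)\<^sup>2 + (n - 1)\<^sup>2 = 4 * n + (n - 1)\<^sup>2"
    by (simp add: n_def norm_prod_square power_mult_distrib)
  also have "\<dots> = (n + 1)\<^sup>2" by (simp add: power2_eq_square algebra_simps)
  finally have "((2 * fst z)\<^sup>2 + (2 * snd z)\<^sup>2 + (n - 1)\<^sup>2) / (n + 1)\<^sup>2 = 1"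
    using pos by simp
  then show ?thesis
    unfolding mem_unit_sphere_iff inv_stereo_eq n_def[symmetric]
    by (simp add: power_divide add_divide_distrib)
qed

lemma inv_stereo_neq_north_pole: "inv_stereo z \<noteq> north_pole"
proof
  assume "inv_stereo z = north_pole"
  moreover have "(norm z)\<^sup>2 + 1 > 0" by (simp add: add_nonneg_pos)
  ultimately show False
    by (simp add: inv_stereo_eq north_pole_def field_simps)
qed

lemma north_pole_in_sphere: "north_pole \<in> sphere 0 1"
  by (simp add: mem_unit_sphere_iff north_pole_def)

text \<open>Height at least 1 uses up the whole norm, so both horizontal coordinates vanish. Away
  from the pole the denominators in \<open>stereo\<close> are therefore positive.\<close>

lemma sphere_height_less_1:
  assumes "x \<in> sphere 0 1" "x \<noteq> north_pole"
  shows "snd (snd x) < 1"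
proof (rule ccontr)
  assume "\<not> snd (snd x) < 1"
  then have "1 \<le> (snd (snd x))\<^sup>2" by simp
  moreover have "(fst x)\<^sup>2 + (fst (snd x))\<^sup>2 + (snd (snd x))\<^sup>2 = 1"
    using assms by (simp only: mem_unit_sphere_iff)
  ultimately have "(fst x)\<^sup>2 + (fst (snd x))\<^sup>2 \<le> 0" "(snd (snd x))\<^sup>2 = 1"
    by (smt (verit) zero_le_power2)+
  then have "fst x = 0" "fst (snd x) = 0" "snd (snd x) = 1"
    using \<open>\<not> snd (snd x) < 1\<close> by (auto simp: sum_power2_le_zero_iff power2_eq_1_iff)
  then show False
    using assms by (simp add: north_pole_def prod_eq_iff)
qed

lemma inv_stereo_stereo:
  assumes "x \<in> sphere 0 1" "x \<noteq> north_pole"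
  shows "inv_stereo (stereo x) = x"
proof -
  obtain a b c where x: "x = (a, b, c)" by (metis surj_pair)
  have c: "1 - c > 0" using sphere_height_less_1[OF assms] x by simp
  have sum: "a\<^sup>2 + b\<^sup>2 = (1 - c) * (1 + c)"
    using assms(1) unfolding mem_unit_sphere_iff by (simp add: x power2_eq_square algebra_simps)
  have "(norm (stereo x))\<^sup>2 = (a\<^sup>2 + b\<^sup>2) / (1 - c)\<^sup>2"
    by (simp add: norm_prod_square stereo_def x power_divide add_divide_distrib)
  also have "\<dots> = (1 + c) / (1 - c)"
    using c unfolding sum by (simp add: power2_eq_square)
  finally have n: "(norm (stereo x))\<^sup>2 = (1 + c) / (1 - c)" .
  have "(1 + c) / (1 - c) + 1 = 2 / (1 - c)" "(1 + c) / (1 - c) - 1 = 2 * c / (1 - c)"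
    using c by (simp_all add: field_simps)
  then show ?thesis
    using c by (simp add: inv_stereo_eq n) (simp add: stereo_def x)
qed

lemma tendsto_stereo:
  assumes "(f \<longlongrightarrow> x) F" "x \<in> sphere 0 1" "x \<noteq> north_pole"
  shows "((\<lambda>n. stereo (f n)) \<longlongrightarrow> stereo x) F"
  unfolding stereo_def
  by (intro tendsto_intros assms) (use sphere_height_less_1[OF assms(2,3)] in auto)

section \<open>Configurations\<close>

lemma hat_subset_sphere: "hat g \<subseteq> sphere 0 1"
  using north_pole_in_sphere inv_stereo_in_sphere by (auto simp: hat_def)

lemma hat_nonempty: "hat g \<noteq> {}"
  by (simp add: hat_def)

lemma stereo_in_if_in_hat: "x \<in> hat g \<Longrightarrow> x \<noteq> north_pole \<Longrightarrow> stereo x \<in> g"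
  by (auto simp: hat_def stereo_inv_stereo)

text \<open>Reads a limit set on the sphere back as a set in the plane: only the pole is missed by
  \<open>inv_stereo\<close>, and \<open>hat\<close> adds it again.\<close>

lemma hat_eqI:
  assumes "F \<subseteq> sphere 0 1" "north_pole \<in> F"
  shows "hat {z. inv_stereo z \<in> F} = F"
proof
  show "F \<subseteq> hat {z. inv_stereo z \<in> F}"
  proof
    fix x assume "x \<in> F"
    moreover have "x = inv_stereo (stereo x)" if "x \<noteq> north_pole"
      using that inv_stereo_stereo[of x] assms \<open>x \<in> F\<close> by auto
    ultimately show "x \<in> hat {z. inv_stereo z \<in> F}"
      by (cases "x = north_pole") (auto simp: hat_def intro!: image_eqI)
  qed
qed (use assms in \<open>auto simp: hat_def\<close>)

text \<open>The pole is not in the range of \<open>inv_stereo\<close>, so \<open>g\<close> is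
  recovered as the preimage of \<open>hat g\<close>.\<close>

lemma hat_inject: "hat g1 = hat g2 \<Longrightarrow> g1 = g2"
proof -
  have "g = {z. inv_stereo z \<in> hat g}" for g
    by (auto simp: hat_def inv_stereo_neq_north_pole) (metis stereo_inv_stereo)
  then show "hat g1 = hat g2 \<Longrightarrow> g1 = g2" by metis
qed

lemma l1_dist_le: "l1_dist z w \<le> 2 * dist z w"
  using dist_fst_le[of z w] dist_snd_le[of z w] by (simp add: l1_dist_def dist_real_def)

text \<open>Euclidean distance below \<open>s / 2\<close> forces \<open>L^1\<close> distance below
  \<open>s\<close>, so \<open>g\<close> is uniformly discrete. Countability thus comes from
  separation and need not be carried through limits.\<close>

lemma separated_closed_countable:
  assumes "s > 0" "pairwise (\<lambda>z w. l1_dist z w \<ge> s) g"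
  shows "closed g" "countable g"
proof -
  have sep: "y = x" if "x \<in> g" "y \<in> g" "dist y x < s / 2" for x y
    using assms that l1_dist_le[of y x] by (fastforce simp: pairwise_def)
  then show "closed g"
    using assms by (intro discrete_imp_closed[of "s / 2"]) auto
  have "uniform_discrete g"
    using assms(1) sep by (intro uniformI2[of "s / 2"]) (metis half_gt_zero not_le)+
  then show "countable g"
    using sparse_imp_countable[OF open_UNIV uniform_discrete_imp_sparse] by auto
qed

text \<open>The points of \<open>hat g\<close> can accumulate only at the pole: a sequence with
  another limit eventually avoids the pole and is carried by \<open>stereo\<close> into
  \<open>g\<close>, which is closed in the plane.\<close>

lemma closed_hat:
  assumes "s > 0" "g \<in> Conf s"
  shows "closed (hat g)"
  unfolding closed_sequential_limits
proof (intro allI impI, elim conjE)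
  fix X x assume X: "\<forall>n. X n \<in> hat g" and lim: "X \<longlonglongrightarrow> x"
  have x: "x \<in> sphere 0 1"
    by (rule closed_sequentially[OF closed_sphere _ lim]) (use X hat_subset_sphere in blast)
  show "x \<in> hat g"
  proof (cases "x = north_pole")
    case False
    then have "\<forall>\<^sub>F n in sequentially. X n \<noteq> north_pole"
      using lim tendsto_imp_eventually_ne by blast
    then have ev: "\<forall>\<^sub>F n in sequentially. stereo (X n) \<in> g"
      by eventually_elim (use X stereo_in_if_in_hat in blast)
    have "closed g"
      using assms separated_closed_countable(1) by (auto simp: Conf_def)
    then have "stereo x \<in> g"
      by (rule Lim_in_closed_set[OF _ ev trivial_limit_sequentially tendsto_stereo[OF lim x False]])
    then show ?thesis
      using inv_stereo_stereo[OF x False] unfolding hat_def by (metis image_eqI insertI2)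
  qed (simp add: hat_def)
qed

section \<open>The metric axioms for \<open>d_H\<close>\<close>

lemma d_H_eq: "d_H g1 g2 = max (geodesic_excess (hat g1) (hat g2)) (geodesic_excess (hat g2) (hat g1))"
  by (simp add: d_H_def geodesic_excess_def geodesic_infdist_def geodesic_dist_commute)

lemma Metric_space_Conf:
  assumes "s > 0"
  shows "Metric_space (Conf s) d_H"
proof
  fix x y z
  show "0 \<le> d_H x y"
    by (simp add: d_H_eq geodesic_excess_nonneg hat_subset_sphere hat_nonempty le_max_iff_disj)
  show "d_H x y = d_H y x"
    by (simp add: d_H_eq max.commute)
  show "d_H x y = 0 \<longleftrightarrow> x = y" if "x \<in> Conf s" "y \<in> Conf s"
  proof
    assume "d_H x y = 0"
    then have "geodesic_excess (hat x) (hat y) \<le> 0" "geodesic_excess (hat y) (hat x) \<le> 0"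
      unfolding d_H_eq by linarith+
    \<comment> \<open>Zero excess in both directions gives both inclusions because the hats are
      closed.\<close>
    then have "hat x = hat y"
      using geodesic_excess_eq_0_imp_subset hat_subset_sphere hat_nonempty
        closed_hat[OF assms] that by (metis subset_antisym)
    then show "x = y" by (rule hat_inject)
  next
    assume "x = y"
    then show "d_H x y = 0"
      by (simp add: d_H_eq geodesic_excess_self hat_subset_sphere hat_nonempty)
  qed
  have "geodesic_excess (hat x) (hat z) \<le> geodesic_excess (hat x) (hat y) + geodesic_excess (hat y) (hat z)"
       "geodesic_excess (hat z) (hat x) \<le> geodesic_excess (hat z) (hat y) + geodesic_excess (hat y) (hat x)"
    by (intro geodesic_excess_triangle hat_subset_sphere hat_nonempty)+
  then show "d_H x z \<le> d_H x y + d_H y z"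
    unfolding d_H_eq by linarith
qed

section \<open>Sequential compactness\<close>

lemma geodesic_infdist_subseq_convergent:
  fixes A :: "nat \<Rightarrow> (real \<times> real \<times> real) set"
  assumes sub: "\<And>n. A n \<subseteq> sphere 0 1" and ne: "\<And>n. A n \<noteq> {}"
  obtains f r where "continuous_on (sphere 0 1) f" "strict_mono (r :: nat \<Rightarrow> nat)"
    "\<And>e. 0 < e \<Longrightarrow> \<exists>N. \<forall>n x. n \<ge> N \<and> x \<in> sphere 0 1 \<longrightarrow> \<bar>geodesic_infdist x (A (r n)) - f x\<bar> < e"
proof -
  have eq: "\<exists>d>0. \<forall>n y. y \<in> sphere 0 1 \<and> norm (x - y) < d \<longrightarrow>
      norm (geodesic_infdist x (A n) - geodesic_infdist y (A n)) < e"
    if x: "x \<in> sphere 0 1" and e: "0 < e" for x and e :: real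
  proof -
    \<comment> \<open>The Lipschitz bound is in the angular distance, while equicontinuity is asked
      for in the norm. Continuity of \<open>geodesic_dist x\<close> at \<open>x\<close>, where it
      vanishes, converts one into the other.\<close>
    have "geodesic_dist x x = 0" using x geodesic_dist_eq_0_iff by blast
    then obtain d where d: "d > 0"
      "\<And>y. y \<in> sphere 0 1 \<Longrightarrow> dist y x < d \<Longrightarrow> \<bar>geodesic_dist x y\<bar> < e"
      using continuous_on_geodesic_dist[OF x, unfolded continuous_on_iff] x e
      by (metis dist_real_def diff_zero)
    show ?thesis
    proof (intro exI[of _ d] conjI allI impI \<open>d > 0\<close>)
      fix n y assume y: "y \<in> sphere 0 1 \<and> norm (x - y) < d"
      then have "\<bar>geodesic_dist x y\<bar> < e"
        using d(2)[of y] by (simp add: dist_norm norm_minus_commute)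
      then show "norm (geodesic_infdist x (A n) - geodesic_infdist y (A n)) < e"
        using geodesic_infdist_Lipschitz[OF x _ sub ne, of y n] y by simp
    qed
  qed
  have "norm (geodesic_infdist x (A n)) \<le> pi" if "x \<in> sphere 0 1" for n x
    using geodesic_infdist_bounds[OF that sub ne, of n] by simp
  then show ?thesis
    by (rule Arzela_Ascoli[OF compact_sphere[of 0 1], of "\<lambda>n x. geodesic_infdist x (A n)" pi])
       (use eq that in \<open>auto simp: real_norm_def\<close>)
qed

text \<open>Both claims come from points \<open>a n\<close> of \<open>A n\<close> nearest to
  \<open>x\<close>. An accumulation point of them is a zero of \<open>f\<close> at distance
  \<open>f x\<close> from \<open>x\<close>; and if \<open>f x = 0\<close>, they converge to
  \<open>x\<close> themselves.\<close>

lemma geodesic_infdist_uniform_limit: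
  fixes A :: "nat \<Rightarrow> (real \<times> real \<times> real) set"
  assumes sub: "\<And>n. A n \<subseteq> sphere 0 1" and ne: "\<And>n. A n \<noteq> {}" and cl: "\<And>n. closed (A n)"
    and cont: "continuous_on (sphere 0 1) f"
    and lim: "\<And>e. 0 < e \<Longrightarrow>
      \<exists>N. \<forall>n x. n \<ge> N \<and> x \<in> sphere 0 1 \<longrightarrow> \<bar>geodesic_infdist x (A n) - f x\<bar> < e"
    and x: "x \<in> sphere 0 1"
  shows "geodesic_infdist x {y \<in> sphere 0 1. f y = 0} \<le> f x"
    and "f x = 0 \<Longrightarrow> \<exists>a. (\<forall>n. a n \<in> A n) \<and> a \<longlonglongrightarrow> x"
proof -
  have tends: "(\<lambda>n. geodesic_infdist x (A n)) \<longlonglongrightarrow> f x"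
    using lim x unfolding LIMSEQ_iff by (metis real_norm_def)
  have "\<forall>n. \<exists>a. a \<in> A n \<and> geodesic_dist x a = geodesic_infdist x (A n)"
    using geodesic_infdist_attained[OF x sub ne cl] by metis
  then obtain a where a: "\<And>n. a n \<in> A n" "\<And>n. geodesic_dist x (a n) = geodesic_infdist x (A n)"
    by metis
  have aS: "a n \<in> sphere 0 1" for n
    using a(1) sub by blast
  show "geodesic_infdist x {y \<in> sphere 0 1. f y = 0} \<le> f x"
  proof -
    obtain y r where y: "y \<in> sphere 0 1" "strict_mono r" "(a \<circ> r) \<longlonglongrightarrow> y"
      using compact_sphere[of 0 1, unfolded compact_def] aS by blast
    have ay: "(\<lambda>n. a (r n)) \<longlonglongrightarrow> y" using y(3) by (simp add: o_def)
    have 1: "(\<lambda>n. f (a (r n))) \<longlonglongrightarrow> f y"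
      by (rule continuous_on_tendsto_compose[OF cont ay y(1)]) (use aS in auto)
    \<comment> \<open>The distance function of \<open>A n\<close> vanishes at \<open>a n\<close>; as
      the point moves with \<open>n\<close>, the convergence to \<open>f\<close> has to be uniform
      here.\<close>
    have 2: "(\<lambda>n. f (a n)) \<longlonglongrightarrow> 0"
    proof (rule LIMSEQ_I)
      fix e :: real assume "0 < e"
      then obtain N where "\<forall>n x. n \<ge> N \<and> x \<in> sphere 0 1 \<longrightarrow> \<bar>geodesic_infdist x (A n) - f x\<bar> < e"
        using lim by blast
      then have "\<forall>n\<ge>N. \<bar>f (a n)\<bar> < e"
        using aS geodesic_infdist_self[OF sub a(1)] by (metis abs_minus_cancel diff_0)
      then show "\<exists>no. \<forall>n\<ge>no. norm (f (a n) - 0) < e" by auto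
    qed
    have "f y = 0"
      using LIMSEQ_unique[OF 1] LIMSEQ_subseq_LIMSEQ[OF 2 y(2)] by (simp add: o_def)
    then have "geodesic_infdist x {y \<in> sphere 0 1. f y = 0} \<le> geodesic_dist x y"
      using x y(1) by (intro geodesic_infdist_le) auto
    also have "geodesic_dist x y = f x"
    proof (rule LIMSEQ_unique)
      show "(\<lambda>n. geodesic_dist x (a (r n))) \<longlonglongrightarrow> geodesic_dist x y"
        by (rule continuous_on_tendsto_compose[OF continuous_on_geodesic_dist[OF x] ay y(1)])
           (use aS in auto)
      show "(\<lambda>n. geodesic_dist x (a (r n))) \<longlonglongrightarrow> f x"
        using LIMSEQ_subseq_LIMSEQ[OF tends y(2)] a(2) by (simp add: o_def)
    qed
    finally show ?thesis .
  qed
  show "\<exists>a. (\<forall>n. a n \<in> A n) \<and> a \<longlonglongrightarrow> x" if "f x = 0"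
  proof -
    \<comment> \<open>Angles tending to 0 mean inner products tending to 1, and for unit vectors the
      chord is \<open>sqrt (2 - 2 * (x \<bullet> a n))\<close>.\<close>
    have "(\<lambda>n. geodesic_dist x (a n)) \<longlonglongrightarrow> 0"
      using tends a(2) that by simp
    then have "(\<lambda>n. cos (geodesic_dist x (a n))) \<longlonglongrightarrow> cos 0"
      by (intro tendsto_intros)
    moreover have "cos (geodesic_dist x (a n)) = x \<bullet> a n" for n
      using unit_inner_bounds[OF x aS[of n]] by (simp add: geodesic_dist_def)
    ultimately have "(\<lambda>n. x \<bullet> a n) \<longlonglongrightarrow> 1" by simp
    then have "(\<lambda>n. sqrt (2 - 2 * (x \<bullet> a n))) \<longlonglongrightarrow> sqrt (2 - 2 * 1)"
      by (intro tendsto_intros)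
    moreover have "norm (a n - x) = sqrt (2 - 2 * (x \<bullet> a n))" for n
      using x aS[of n] by (simp add: norm_eq_sqrt_inner inner_diff inner_commute norm_eq_1)
    ultimately have "(\<lambda>n. norm (a n - x)) \<longlonglongrightarrow> 0" by simp
    then have "a \<longlonglongrightarrow> x"
      by (metis LIM_zero_cancel tendsto_norm_zero_cancel)
    then show ?thesis using a(1) by blast
  qed
qed

text \<open>Away from the pole the approximating points come from points of \<open>g n\<close>
  converging in the plane, and the closed condition \<open>s \<le> l1_dist\<close> survives the
  limit.\<close>

lemma Conf_limit:
  assumes "s > 0" and g: "\<And>n. g n \<in> Conf s"
    and F: "F \<subseteq> sphere 0 1"
    and lim: "\<And>x. x \<in> F \<Longrightarrow> \<exists>a. (\<forall>n. a n \<in> hat (g n)) \<and> a \<longlonglongrightarrow> x"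
  shows "{z. inv_stereo z \<in> F} \<in> Conf s"
proof -
  have approx: "\<exists>y. y \<longlonglongrightarrow> z \<and> (\<forall>\<^sub>F n in sequentially. y n \<in> g n)"
    if z: "inv_stereo z \<in> F" for z
  proof -
    obtain a where a: "\<And>n. a n \<in> hat (g n)" "a \<longlonglongrightarrow> inv_stereo z"
      using lim[OF z] by blast
    have "\<forall>\<^sub>F n in sequentially. a n \<noteq> north_pole"
      using a(2) inv_stereo_neq_north_pole tendsto_imp_eventually_ne by blast
    then have "\<forall>\<^sub>F n in sequentially. stereo (a n) \<in> g n"
      by eventually_elim (use a stereo_in_if_in_hat in blast)
    moreover have "(\<lambda>n. stereo (a n)) \<longlonglongrightarrow> z"
      using tendsto_stereo[OF a(2) inv_stereo_in_sphere inv_stereo_neq_north_pole]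
      by (simp add: stereo_inv_stereo)
    ultimately show ?thesis by blast
  qed
  have "pairwise (\<lambda>z w. l1_dist z w \<ge> s) {z. inv_stereo z \<in> F}"
    unfolding pairwise_def mem_Collect_eq
  proof (intro ballI impI)
    fix z w assume z: "z \<in> {z. inv_stereo z \<in> F}" and w: "w \<in> {z. inv_stereo z \<in> F}"
      and "z \<noteq> w"
    obtain y where y: "y \<longlonglongrightarrow> z" "\<forall>\<^sub>F n in sequentially. y n \<in> g n"
      using approx[of z] z by blast
    obtain y' where y': "y' \<longlonglongrightarrow> w" "\<forall>\<^sub>F n in sequentially. y' n \<in> g n"
      using approx[of w] w by blast
    \<comment> \<open>Separation in \<open>g n\<close> applies only to distinct points, and distinct
      limits make \<open>y n\<close> and \<open>y' n\<close> eventually distinct.\<close>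
    have "(\<lambda>n. y n - y' n) \<longlonglongrightarrow> z - w"
      by (intro tendsto_intros y y')
    then have "\<forall>\<^sub>F n in sequentially. y n - y' n \<noteq> 0"
      by (rule tendsto_imp_eventually_ne) (simp add: \<open>z \<noteq> w\<close>)
    with y(2) y'(2) have "\<forall>\<^sub>F n in sequentially. s \<le> l1_dist (y n) (y' n)"
      by eventually_elim (use g in \<open>auto simp: Conf_def pairwise_def\<close>)
    moreover have "(\<lambda>n. l1_dist (y n) (y' n)) \<longlonglongrightarrow> l1_dist z w"
      unfolding l1_dist_def by (intro tendsto_intros y y')
    ultimately show "s \<le> l1_dist z w"
      by (intro tendsto_lowerbound[OF _ _ trivial_limit_sequentially])
  qed
  then show ?thesis
    using separated_closed_countable(2)[OF assms(1)] by (auto simp: Conf_def)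
qed

lemma compact_space_Conf:
  assumes "s > 0"
  shows "compact_space (Metric_space.mtopology (Conf s) d_H)"
proof -
  interpret Metric_space "Conf s" d_H by (rule Metric_space_Conf) fact
  show ?thesis
    unfolding compact_space_sequentially
  proof (intro allI impI)
    fix \<sigma> :: "nat \<Rightarrow> (real \<times> real) set"
    assume "range \<sigma> \<subseteq> Conf s"
    then have \<sigma>: "\<sigma> n \<in> Conf s" for n by auto
    obtain f r where cont: "continuous_on (sphere 0 1) f" and r: "strict_mono (r :: nat \<Rightarrow> nat)"
      and lim: "\<And>e. 0 < e \<Longrightarrow> \<exists>N. \<forall>n x. n \<ge> N \<and> x \<in> sphere 0 1 \<longrightarrow>
        \<bar>geodesic_infdist x (hat (\<sigma> (r n))) - f x\<bar> < e"
      using geodesic_infdist_subseq_convergent[of "\<lambda>n. hat (\<sigma> n)"]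
        hat_subset_sphere hat_nonempty by metis
    define F where "F = {y \<in> sphere 0 1. f y = 0}"
    note ul = geodesic_infdist_uniform_limit[of "\<lambda>n. hat (\<sigma> (r n))" f,
        OF hat_subset_sphere hat_nonempty closed_hat[OF assms \<sigma>] cont lim]
    define l where "l = {z. inv_stereo z \<in> F}"
    have l: "l \<in> Conf s"
      unfolding l_def using ul(2)
      by (intro Conf_limit[OF assms, of "\<lambda>n. \<sigma> (r n)"] \<sigma>) (auto simp: F_def)
    \<comment> \<open>The pole lies in every hat, so all the distance functions vanish there. Hence
      the zero set \<open>F\<close> contains the pole and is itself a hat.\<close>
    have "f north_pole = 0"
    proof (rule ccontr)
      assume "f north_pole \<noteq> 0"
      then obtain N where "\<And>n. n \<ge> N \<Longrightarrow>
          \<bar>geodesic_infdist north_pole (hat (\<sigma> (r n))) - f north_pole\<bar> < \<bar>f north_pole\<bar>"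
        using lim[of "\<bar>f north_pole\<bar>"] north_pole_in_sphere by (metis zero_less_abs_iff)
      from this[of N] show False
        using geodesic_infdist_self[OF hat_subset_sphere, of north_pole] by (simp add: hat_def)
    qed
    then have hat_l: "hat l = F"
      unfolding l_def using north_pole_in_sphere by (intro hat_eqI) (auto simp: F_def)
    have "limitin mtopology (\<sigma> \<circ> r) l sequentially"
      unfolding limitin_metric
    proof (intro conjI allI impI l)
      fix e :: real assume "e > 0"
      then obtain N where N: "\<And>n x. n \<ge> N \<Longrightarrow> x \<in> sphere 0 1 \<Longrightarrow>
          \<bar>geodesic_infdist x (hat (\<sigma> (r n))) - f x\<bar> < e / 2"
        using lim[of "e / 2"] by (metis half_gt_zero)
      \<comment> \<open>Suprema preserve only non-strict bounds, so \<open>e / 2\<close> is used to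
        end strictly below \<open>e\<close>.\<close>
      have "d_H (\<sigma> (r n)) l \<le> e / 2" if "n \<ge> N" for n
      proof -
        \<comment> \<open>On \<open>F\<close> the limit \<open>f\<close> is 0, so the distance to
          the hat is itself the approximation error.\<close>
        have "geodesic_excess F (hat (\<sigma> (r n))) \<le> e / 2"
        proof (rule geodesic_excess_least)
          show "F \<noteq> {}" using hat_l hat_nonempty by metis
          show "geodesic_infdist a (hat (\<sigma> (r n))) \<le> e / 2" if "a \<in> F" for a
            using N[OF \<open>n \<ge> N\<close>, of a] that by (auto simp: F_def)
        qed
        \<comment> \<open>On the hat its own distance function is 0, so \<open>f\<close> is the
          error, and \<open>f\<close> dominates the distance to \<open>F\<close>.\<close>
        moreover have "geodesic_excess (hat (\<sigma> (r n))) F \<le> e / 2"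
        proof (rule geodesic_excess_least[OF hat_nonempty])
          fix a assume a: "a \<in> hat (\<sigma> (r n))"
          then have aS: "a \<in> sphere 0 1" using hat_subset_sphere by blast
          have "geodesic_infdist a F \<le> f a"
            unfolding F_def by (rule ul(1)[OF _ aS])
          also have "\<dots> \<le> e / 2"
            using N[OF \<open>n \<ge> N\<close> aS] geodesic_infdist_self[OF hat_subset_sphere a] by simp
          finally show "geodesic_infdist a F \<le> e / 2" .
        qed
        ultimately show ?thesis by (simp add: d_H_eq hat_l)
      qed
      then have "\<forall>n\<ge>N. d_H (\<sigma> (r n)) l < e"
        using \<open>e > 0\<close> by (smt (verit) field_sum_of_halves)
      then show "\<forall>\<^sub>F n in sequentially. (\<sigma> \<circ> r) n \<in> Conf s \<and> d_H ((\<sigma> \<circ> r) n) l < e"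
        using \<sigma> by (auto simp: eventually_sequentially)
    qed
    then show "\<exists>l r. l \<in> Conf s \<and> strict_mono r \<and> limitin mtopology (\<sigma> \<circ> r) l sequentially"
      using l r by blast
  qed
qed

theorem proposition1:
  fixes s :: real
  assumes "s > 0"
  shows "Metric_space (Conf s) d_H
       \<and> compact_space (Metric_space.mtopology (Conf s) d_H)
       \<and> Baire_space (Metric_space.mtopology (Conf s) d_H)"
proof -
  interpret Metric_space "Conf s" d_H by (rule Metric_space_Conf) fact
  have compact: "compact_space mtopology"
    using compact_space_Conf[OF assms] .
  have "Baire_space mtopology"
    unfolding Baire_space_def
  proof (intro allI impI, elim conjE)
    fix \<G> assume \<G>: "countable \<G>" "\<forall>U\<in>\<G>. openin mtopology U \<and> mtopology closure_of U = topspace mtopology"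
    \<comment> \<open>A compact metric space is complete, so the Baire category theorem applies.
      Inserting the whole space, which is open and dense, turns the intersection relative to the
      space into a plain one.\<close>
    have "mtopology closure_of \<Inter>(insert (Conf s) \<G>) = Conf s"
      using \<G> openin_topspace[of mtopology] closure_of_topspace[of mtopology]
      by (intro metric_Baire_category compact_space_imp_mcomplete compact) auto
    then show "mtopology closure_of (topspace mtopology \<inter> \<Inter>\<G>) = topspace mtopology"
      by simp
  qed
  then show ?thesis
    using compact Metric_space_axioms by simp
qed

end
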